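(* Let $T$ be a closed densely defined operator on a Hilbert space $\mathfrak{H}$ with the polar decomposition $T=W|T|$. Assume that $G$ is a bounded operator on $\mathfrak{H}$ such that both $GT$ and $G^*T^*$ are accretive (resp. strictly accretive). Then the products $GW$ and $WG$ are also accretive (resp. strictly accretive) operators.
   Context: An operator $T$ on the Hilbert space $\mathfrak{H}$ is called accretive (resp. strictly accretive) if $\operatorname{Re}\langle x,Tx\rangle\ge0$ (resp. $\operatorname{Re}\langle x,Tx\rangle>0$) for any $x\in\operatorname{Dom}(T)$ with $\|x\|=1$. The partial isometry $W$ in the polar decomposition $T=W|T|$ is extended to $\operatorname{Ker}(T)$ by $W|_{\operatorname{Ker}(T)}=0$, so that $W$ is uniquely defined on all of $\mathfrak{H}$. *)

theory Defs
  imports "HOL-Analysis.Analysis"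
begin

text \<open>
  The real inner product of the class \<open>real_inner\<close> is required to be the real part of the
  complex one, so that norm, topology and completeness are those of the complex inner product
  (see \<open>cinner_self\<close> below).  The inner product is linear in its second argument.
\<close>

class complex_hilbert_space = real_inner + complete_space +
  fixes scaleC :: "complex \<Rightarrow> 'a \<Rightarrow> 'a"  (infixr "*\<^sub>C" 75)
    and cinner :: "'a \<Rightarrow> 'a \<Rightarrow> complex"
  assumes scaleC_add_right: "a *\<^sub>C (x + y) = a *\<^sub>C x + a *\<^sub>C y"
    and scaleC_add_left: "(a + b) *\<^sub>C x = a *\<^sub>C x + b *\<^sub>C x"
    and scaleC_scaleC: "a *\<^sub>C b *\<^sub>C x = (a * b) *\<^sub>C x"
    and scaleC_of_real: "complex_of_real r *\<^sub>C x = r *\<^sub>R x"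
    and cinner_add_right: "cinner x (y + z) = cinner x y + cinner x z"
    and cinner_scaleC_right: "cinner x (a *\<^sub>C y) = a * cinner x y"
    and cinner_commute: "cinner x y = cnj (cinner y x)"
    and inner_eq_Re_cinner: "x \<bullet> y = Re (cinner x y)"

lemma cinner_self:
  fixes x :: "'a :: complex_hilbert_space"
  shows "cinner x x = complex_of_real ((norm x)\<^sup>2)"
proof (rule complex_eqI)
  show "Re (cinner x x) = Re (complex_of_real ((norm x)\<^sup>2))"
    by (simp add: power2_norm_eq_inner inner_eq_Re_cinner)
  have "Im (cinner x x) = - Im (cinner x x)"
    by (subst cinner_commute) simp
  then show "Im (cinner x x) = Im (complex_of_real ((norm x)\<^sup>2))"
    by simp
qed

instantiation complex :: complex_hilbert_space
begin

definition scaleC_complex :: "complex \<Rightarrow> complex \<Rightarrow> complex"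
  where "scaleC_complex a x = a * x"

definition cinner_complex :: "complex \<Rightarrow> complex \<Rightarrow> complex"
  where "cinner_complex x y = cnj x * y"

instance
  by standard
    (simp_all add: scaleC_complex_def cinner_complex_def algebra_simps inner_complex_def
      scaleR_conv_of_real)

end

text \<open>
  A possibly unbounded operator is represented by its graph, so that equality of operators
  includes equality of their domains; the domain is \<^term>\<open>Domain T\<close>.
\<close>

type_synonym 'a operator = "('a \<times> 'a) set"

definition linear_operator :: "'a :: complex_hilbert_space operator \<Rightarrow> bool" where
  "linear_operator T \<longleftrightarrow>
     single_valued T \<and> (0, 0) \<in> T \<and>
     (\<forall>x y x' y'. (x, y) \<in> T \<longrightarrow> (x', y') \<in> T \<longrightarrow> (x + x', y + y') \<in> T) \<and>
     (\<forall>a x y. (x, y) \<in> T \<longrightarrow> (a *\<^sub>C x, a *\<^sub>C y) \<in> T)"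

definition densely_defined :: "'a :: complex_hilbert_space operator \<Rightarrow> bool" where
  "densely_defined T \<longleftrightarrow> closure (Domain T) = UNIV"

definition closed_operator :: "'a :: complex_hilbert_space operator \<Rightarrow> bool" where
  "closed_operator T \<longleftrightarrow> linear_operator T \<and> closed T"

definition bounded_operator :: "'a :: complex_hilbert_space operator \<Rightarrow> bool" where
  "bounded_operator T \<longleftrightarrow>
     linear_operator T \<and> Domain T = UNIV \<and> (\<exists>K. \<forall>(x, y) \<in> T. norm y \<le> K * norm x)"

definition op_ker :: "'a :: complex_hilbert_space operator \<Rightarrow> 'a set" where
  "op_ker T = {x. (x, 0) \<in> T}"

text \<open>
  The product \<open>S T\<close> (first \<open>T\<close>, then \<open>S\<close>), with domain
  \<open>{x \<in> Dom T. T x \<in> Dom S}\<close>.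
\<close>

definition op_mult :: "'a operator \<Rightarrow> 'a operator \<Rightarrow> 'a operator"  (infixl "\<cdot>" 70) where
  "S \<cdot> T = T O S"

text \<open>
  This set of pairs is the graph of an operator whenever \<open>T\<close> is densely defined.
\<close>

definition op_adjoint :: "'a :: complex_hilbert_space operator \<Rightarrow> 'a operator" where
  "op_adjoint T = {(y, z). \<forall>(x, w) \<in> T. cinner y w = cinner z x}"

definition self_adjoint :: "'a :: complex_hilbert_space operator \<Rightarrow> bool" where
  "self_adjoint T \<longleftrightarrow> linear_operator T \<and> densely_defined T \<and> op_adjoint T = T"

definition positive_operator :: "'a :: complex_hilbert_space operator \<Rightarrow> bool" where
  "positive_operator T \<longleftrightarrow> (\<forall>(x, y) \<in> T. cinner x y \<in> \<real>\<^sub>\<ge>\<^sub>0)"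

text \<open>
  \<open>A = |T|\<close>, that is, \<open>A\<close> is the positive self-adjoint square root of \<open>T\<^sup>* T\<close>, which
  exists and is unique for closed densely defined \<open>T\<close>.
\<close>

definition is_modulus :: "'a :: complex_hilbert_space operator \<Rightarrow> 'a operator \<Rightarrow> bool" where
  "is_modulus A T \<longleftrightarrow> self_adjoint A \<and> positive_operator A \<and> A \<cdot> A = op_adjoint T \<cdot> T"

definition partial_isometry :: "'a :: complex_hilbert_space operator \<Rightarrow> bool" where
  "partial_isometry W \<longleftrightarrow>
     bounded_operator W \<and>
     (\<forall>(x, y) \<in> W. (\<forall>k \<in> op_ker W. cinner k x = 0) \<longrightarrow> norm y = norm x)"

text \<open>
  \<open>T = W A\<close> with \<open>A = |T|\<close>; the kernel condition is the normalisation \<open>W = 0\<close> on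
  \<open>Ker T\<close>, which makes \<open>W\<close> unique.
\<close>

definition polar_decomposition ::
  "'a :: complex_hilbert_space operator \<Rightarrow> 'a operator \<Rightarrow> 'a operator \<Rightarrow> bool" where
  "polar_decomposition T W A \<longleftrightarrow>
     is_modulus A T \<and> partial_isometry W \<and> T = W \<cdot> A \<and> op_ker W = op_ker T"

definition accretive :: "'a :: complex_hilbert_space operator \<Rightarrow> bool" where
  "accretive T \<longleftrightarrow> (\<forall>(x, y) \<in> T. norm x = 1 \<longrightarrow> Re (cinner x y) \<ge> 0)"

definition strictly_accretive :: "'a :: complex_hilbert_space operator \<Rightarrow> bool" where
  "strictly_accretive T \<longleftrightarrow> (\<forall>(x, y) \<in> T. norm x = 1 \<longrightarrow> Re (cinner x y) > 0)"

end

theory Submission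
  imports Defs
begin

text \<open>
  Write \<open>A = |T|\<close>, \<open>B = G W\<close> and \<open>q u = Re \<langle>u, B u\<rangle>\<close>.  Accretivity of \<open>G T = B A\<close> says
  \<open>Re \<langle>x, B A x\<rangle> \<ge> 0\<close>.  Since \<open>T\<^sup>* W x = A x\<close> for \<open>x\<close> in the domain of \<open>A\<close> orthogonal to
  the kernel of \<open>A\<close>, accretivity of \<open>G\<^sup>* T\<^sup>*\<close> gives \<open>Re \<langle>A x, B x\<rangle> \<ge> 0\<close> as well.  Together they
  say that the Lyapunov form \<open>Re (\<langle>x, B A x\<rangle> + \<langle>A x, B x\<rangle>)\<close> is nonnegative, and the claim about
  \<open>G W\<close> becomes an instance of Lyapunov's theorem: such a \<open>B\<close>, vanishing on the kernel of \<open>A\<close>,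
  has \<open>q \<ge> 0\<close>.

  Lyapunov's theorem is usually derived from the semigroup \<open>exp (- t A)\<close>.  The Cayley
  transform \<open>C = (A - 1) (A + 1)\<^sup>-\<^sup>1\<close> avoids functional calculus.  For \<open>u = A x + x\<close> one has
  \<open>C u = A x - x\<close>, and twice the Lyapunov form at \<open>x\<close> is the difference
  \<open>q u - q (C u)\<close> (\<open>cayley_step\<close>).  Hence \<open>q (C\<^sup>n u)\<close> decreases in \<open>n\<close>, and it remains to see
  that its limit is \<open>0\<close> for a dense set of \<open>u\<close>.  As \<open>C\<close> is a symmetric contraction, its
  powers tend to \<open>0\<close> on the range of \<open>1 - C\<^sup>2\<close> (\<open>powers_tendsto_0\<close>); on the kernel of \<open>A\<close>,
  \<open>C\<close> is \<open>-1\<close> and \<open>B\<close> vanishes; and the sum of these two subspaces is dense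
  (\<open>dense_kernel_plus_range\<close>).  This is \<open>lyapunov_nonneg\<close>.  Under strict hypotheses a single
  step suffices: \<open>q u > q (C u) \<ge> 0\<close> for \<open>u \<noteq> 0\<close>.

  For \<open>W G\<close>, split \<open>v = v\<^sub>0 + W x\<close> with \<open>v\<^sub>0\<close> orthogonal to the range of \<open>W\<close>.  Then \<open>v\<^sub>0\<close> is
  in the kernel of \<open>T\<^sup>*\<close>, and accretivity of \<open>G\<^sup>* T\<^sup>*\<close> forces \<open>G v\<^sub>0\<close> into the kernel of \<open>A\<close>
  (\<open>G_cokernel\<close>).  So \<open>\<langle>v, W G v\<rangle>\<close> reduces to \<open>\<langle>x, G W x\<rangle>\<close>, the case already settled.

  Only real parts of inner products occur, so the argument runs in a real Hilbert space; the
  complex structure enters when the operators of the theorem are translated at the end.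
\<close>

section \<open>Orthogonal projection and the Riesz representation\<close>

text \<open>
  The sets of almost nearest points are closed and nested, and the parallelogram law makes their
  diameters tend to \<open>0\<close>; completeness gives a point common to all of them.
\<close>
lemma nearest_point_exists:
  fixes S :: "'a :: {real_inner, complete_space} set"
  assumes "subspace S" "closed S"
  shows "\<exists>p\<in>S. \<forall>s\<in>S. dist x p \<le> dist x s"
proof -
  define d where "d = (INF s\<in>S. (norm (x - s))\<^sup>2)"
  have bdd: "bdd_below ((\<lambda>s. (norm (x - s))\<^sup>2) ` S)"
    by (rule bdd_belowI[of _ 0]) auto
  have ne: "S \<noteq> {}" using assms(1) subspace_0 by auto
  have d_le: "d \<le> (norm (x - s))\<^sup>2" if "s \<in> S" for s
    unfolding d_def using that by (intro cINF_lower bdd)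
  define F where "F n = S \<inter> {s. (norm (x - s))\<^sup>2 \<le> d + 1 / real (Suc n)}" for n
  obtain p where p: "\<And>n. p \<in> F n"
  proof (rule decreasing_closed_nest[of F])
    show "closed (F n)" for n
      unfolding F_def by (intro closed_Int assms(2) closed_Collect_le continuous_intros)
    show "F n \<noteq> {}" for n
    proof -
      have "(INF s\<in>S. (norm (x - s))\<^sup>2) < d + 1 / real (Suc n)" by (simp add: d_def)
      then obtain s where "s \<in> S" "(norm (x - s))\<^sup>2 < d + 1 / real (Suc n)"
        using ne bdd by (auto simp: cINF_less_iff)
      then have "s \<in> F n" by (simp add: F_def)
      then show ?thesis by auto
    qed
    show "F n \<subseteq> F m" if "m \<le> n" for m n
    proof -
      have "1 / real (Suc n) \<le> 1 / real (Suc m)" using that by (simp add: field_simps)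
      then show ?thesis by (auto simp: F_def)
    qed
    have diam: "(dist s t)\<^sup>2 \<le> 4 / real (Suc n)" if "s \<in> F n" "t \<in> F n" for s t n
    proof -
      have "(1/2) *\<^sub>R (s + t) \<in> S"
        using that assms(1) by (auto simp: F_def intro: subspace_mul subspace_add)
      then have "d \<le> (norm (x - (1/2) *\<^sub>R (s + t)))\<^sup>2" by (rule d_le)
      moreover have "(dist s t)\<^sup>2 = 2 * (norm (x - s))\<^sup>2 + 2 * (norm (x - t))\<^sup>2
          - 4 * (norm (x - (1/2) *\<^sub>R (s + t)))\<^sup>2"
        unfolding dist_norm power2_norm_eq_inner
        by (simp add: inner_diff_left inner_diff_right inner_add_left inner_add_right
            inner_commute algebra_simps)
      moreover have "(norm (x - s))\<^sup>2 \<le> d + 1 / real (Suc n)"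
        "(norm (x - t))\<^sup>2 \<le> d + 1 / real (Suc n)"
        using that by (auto simp: F_def)
      ultimately show ?thesis by simp
    qed
    show "\<exists>n. \<forall>s\<in>F n. \<forall>t\<in>F n. dist s t < e" if "e > 0" for e
    proof -
      have "0 < e\<^sup>2 / 4" using that by simp
      then obtain n where n: "1 / real (Suc n) < e\<^sup>2 / 4" by (rule nat_approx_posE)
      have "dist s t < e" if "s \<in> F n" "t \<in> F n" for s t
      proof -
        have "(dist s t)\<^sup>2 < e\<^sup>2" using diam[OF that] n by simp
        then show ?thesis 
          by (rule power_less_imp_less_base) (use \<open>e > 0\<close> in simp)
      qed
      then show ?thesis by blast
    qed
  qed blast
  have "(norm (x - p))\<^sup>2 \<le> d"
  proof (rule field_le_epsilon)
    fix e :: real assume "e > 0"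
    then obtain n where "1 / real (Suc n) < e" using nat_approx_posE by auto
    then show "(norm (x - p))\<^sup>2 \<le> d + e" using p[of n] by (auto simp: F_def)
  qed
  then have "dist x p \<le> dist x s" if "s \<in> S" for s
    unfolding dist_norm
    by (rule power2_le_imp_le[OF order_trans[OF _ d_le[OF that]]]) simp_all
  then show ?thesis using p[of 0] by (auto simp: F_def)
qed

lemma orthogonal_projection_exists:
  fixes S :: "'a :: {real_inner, complete_space} set"
  assumes "subspace S" "closed S"
  obtains p where "p \<in> S" "\<And>s. s \<in> S \<Longrightarrow> s \<bullet> (x - p) = 0"
proof -
  obtain p where p: "p \<in> S" "\<forall>s\<in>S. dist x p \<le> dist x s"
    using nearest_point_exists[OF assms] by blast
  have le: "(x - p) \<bullet> s \<le> 0" if "s \<in> S" for s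
    using any_closest_point_dot[OF subspace_imp_convex[OF assms(1)] assms(2) p(1) _ p(2), of "p + s"]
      p(1) that assms(1) by (simp add: subspace_add)
  have "s \<bullet> (x - p) = 0" if "s \<in> S" for s
    using le[OF that] le[of "- s"] that assms(1) by (simp add: subspace_neg inner_commute)
  then show ?thesis using that p(1) by blast
qed

lemma riesz_representation:
  fixes f :: "'a :: {real_inner, complete_space} \<Rightarrow> real"
  assumes "bounded_linear f"
  shows "\<exists>z. \<forall>x. f x = z \<bullet> x"
proof (cases "\<forall>x. f x = 0")
  case True
  then have "\<forall>x. f x = 0 \<bullet> x" by simp
  then show ?thesis by blast
next
  case False
  interpret f: bounded_linear f by fact
  obtain a where a: "f a \<noteq> 0" using False by blast
  have sub: "subspace {x. f x = 0}"
    by (auto simp: subspace_def f.add f.scaleR f.zero)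
  have "closed {x. f x = 0}"
    by (intro closed_Collect_eq continuous_intros linear_continuous_on assms)
  then obtain p where p: "f p = 0" "\<And>s. f s = 0 \<Longrightarrow> s \<bullet> (a - p) = 0"
    using orthogonal_projection_exists[OF sub, of a] by auto
  define b where "b = a - p"
  have fb: "f b \<noteq> 0" using a p by (simp add: b_def f.diff)
  then have b: "b \<bullet> b \<noteq> 0" by (auto simp: f.zero)
  have "f x = ((f b / (b \<bullet> b)) *\<^sub>R b) \<bullet> x" for x
  proof -
    have "f (x - (f x / f b) *\<^sub>R b) = 0" using fb by (simp add: f.diff f.scaleR)
    then have "(x - (f x / f b) *\<^sub>R b) \<bullet> b = 0" unfolding b_def by (rule p(2))
    then have "x \<bullet> b = (f x / f b) * (b \<bullet> b)" by (simp add: inner_diff_left)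
    then show ?thesis using fb b by (simp add: inner_commute[of b x])
  qed
  then show ?thesis by blast
qed

lemma subspace_closure:
  fixes S :: "'a :: real_normed_vector set"
  assumes "subspace S"
  shows "subspace (closure S)"
  unfolding subspace_def
proof (intro conjI ballI allI)
  show "0 \<in> closure S"
    using subspace_0[OF assms] closure_subset by blast
  show "x + y \<in> closure S" if xy: "x \<in> closure S" "y \<in> closure S" for x y
  proof -
    obtain f g where fg: "\<And>n. f n \<in> S" "f \<longlonglongrightarrow> x" "\<And>n. g n \<in> S" "g \<longlonglongrightarrow> y"
      using xy unfolding closure_sequential by blast
    then have "\<And>n. f n + g n \<in> S" using subspace_add[OF assms] by blast
    moreover have "(\<lambda>n. f n + g n) \<longlonglongrightarrow> x + y" using fg by (intro tendsto_add)
    ultimately show ?thesis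
      unfolding closure_sequential by (intro exI[of _ "\<lambda>n. f n + g n"]) simp
  qed
  show "c *\<^sub>R x \<in> closure S" if x: "x \<in> closure S" for c x
  proof -
    obtain f where f: "\<And>n. f n \<in> S" "f \<longlonglongrightarrow> x"
      using x unfolding closure_sequential by blast
    then have "\<And>n. c *\<^sub>R f n \<in> S" using subspace_scale[OF assms] by blast
    moreover have "(\<lambda>n. c *\<^sub>R f n) \<longlonglongrightarrow> c *\<^sub>R x" using f by (intro tendsto_intros)
    ultimately show ?thesis
      unfolding closure_sequential by (intro exI[of _ "\<lambda>n. c *\<^sub>R f n"]) simp
  qed
qed

section \<open>Powers of a symmetric contraction\<close>

locale symmetric_contraction =
  fixes C :: "'a :: real_inner \<Rightarrow> 'a"
  assumes linear: "linear C"
    and symmetric: "C x \<bullet> y = x \<bullet> C y"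
    and contraction: "norm (C x) \<le> norm x"
begin

text \<open>
  With \<open>a n = \<parallel>C\<^sup>n w\<parallel>\<^sup>2\<close>, symmetry of \<open>C\<close> makes \<open>\<parallel>C\<^sup>n (w - C\<^sup>2 w)\<parallel>\<^sup>2\<close> equal to the second
  difference of \<open>a\<close>, and \<open>a\<close> converges because it decreases.
\<close>
lemma powers_tendsto_0:
  "(\<lambda>n. (C ^^ n) (w - C (C w))) \<longlonglongrightarrow> 0"
proof -
  have lin: "linear (C ^^ n)" for n
  proof (induction n)
    case 0
    then show ?case by (simp add: linear_ident)
  next
    case (Suc n)
    then show ?case using linear_compose[OF _ linear, of "C ^^ n"] by (simp add: o_def)
  qed
  define a where "a n = (norm ((C ^^ n) w))\<^sup>2" for n
  have "decseq a" unfolding a_def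
    by (intro decseq_SucI power_mono) (auto simp: contraction)
  moreover have "\<forall>i. 0 \<le> a i" by (simp add: a_def)
  ultimately obtain L where L: "a \<longlonglongrightarrow> L" by (rule decseq_convergent)
  have eq: "(norm ((C ^^ n) (w - C (C w))))\<^sup>2 = a n - 2 * a (Suc n) + a (Suc (Suc n))" for n
  proof -
    have "(C ^^ n) (w - C (C w)) = (C ^^ n) w - C (C ((C ^^ n) w))"
      by (simp add: linear_diff[OF lin] funpow_swap1)
    then show ?thesis
      unfolding a_def power2_norm_eq_inner
      by (simp add: inner_diff_left inner_diff_right symmetric inner_commute)
  qed
  have "(\<lambda>n. a n - 2 * a (Suc n) + a (Suc (Suc n))) \<longlonglongrightarrow> L - 2 * L + L"
    by (intro tendsto_intros L LIMSEQ_Suc)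
  then have "(\<lambda>n. (norm ((C ^^ n) (w - C (C w))))\<^sup>2) \<longlonglongrightarrow> 0"
    by (simp add: eq)
  then have "(\<lambda>n. sqrt ((norm ((C ^^ n) (w - C (C w))))\<^sup>2)) \<longlonglongrightarrow> sqrt 0"
    by (rule tendsto_real_sqrt)
  then show ?thesis by (simp add: tendsto_norm_zero_iff)
qed

end

section \<open>The Cayley transform of a positive self-adjoint operator\<close>

text \<open>
  A positive self-adjoint operator given by its graph.  The assumption \<open>graph_iff\<close> states that
  \<open>A\<close> equals its own adjoint; it already implies that the graph is a closed subspace.
\<close>
locale positive_self_adjoint =
  fixes A :: "('a :: {real_inner, complete_space} \<times> 'a) set"
  assumes graph_iff: "(y, z) \<in> A \<longleftrightarrow> (\<forall>(x, w) \<in> A. y \<bullet> w = z \<bullet> x)"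
    and nonneg: "(x, y) \<in> A \<Longrightarrow> x \<bullet> y \<ge> 0"
    and image_0: "(0, y) \<in> A \<Longrightarrow> y = 0"
begin

lemma symmetric: "(x, y) \<in> A \<Longrightarrow> (x', y') \<in> A \<Longrightarrow> x \<bullet> y' = y \<bullet> x'"
  using graph_iff[of x y] by blast

lemma subspace_graph: "subspace A"
  unfolding subspace_def
proof (intro conjI ballI allI)
  show "0 \<in> A" unfolding zero_prod_def by (subst graph_iff) auto
  show "p + q \<in> A" if "p \<in> A" "q \<in> A" for p q
  proof -
    obtain x y x' y' where [simp]: "p = (x, y)" "q = (x', y')" by fastforce
    have "(x + x', y + y') \<in> A"
      using that by (subst graph_iff) (auto simp: inner_add_left symmetric)
    then show ?thesis by simp
  qed
  show "c *\<^sub>R p \<in> A" if "p \<in> A" for c p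
  proof -
    obtain x y where [simp]: "p = (x, y)" by fastforce
    have "(c *\<^sub>R x, c *\<^sub>R y) \<in> A"
      using that by (subst graph_iff) (auto simp: symmetric)
    then show ?thesis by simp
  qed
qed

lemma graph_add: "(x, y) \<in> A \<Longrightarrow> (x', y') \<in> A \<Longrightarrow> (x + x', y + y') \<in> A"
  using subspace_add[OF subspace_graph, of "(x, y)" "(x', y')"] by simp

lemma graph_scaleR: "(x, y) \<in> A \<Longrightarrow> (c *\<^sub>R x, c *\<^sub>R y) \<in> A"
  using subspace_scale[OF subspace_graph, of "(x, y)" c] by simp

lemma graph_diff: "(x, y) \<in> A \<Longrightarrow> (x', y') \<in> A \<Longrightarrow> (x - x', y - y') \<in> A"
  using subspace_diff[OF subspace_graph, of "(x, y)" "(x', y')"] by simp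

lemma graph_0: "(0, 0) \<in> A"
  using subspace_0[OF subspace_graph] by (simp add: zero_prod_def)

lemma closed_graph: "closed A"
proof -
  have "A = (\<Inter>(x, w) \<in> A. {p. fst p \<bullet> w = snd p \<bullet> x})"
    using graph_iff by force
  also have "closed \<dots>"
    by (intro closed_INT ballI) (auto intro!: closed_Collect_eq continuous_intros)
  finally show ?thesis .
qed

definition kernel :: "'a set" where
  "kernel = {x. (x, 0) \<in> A}"

lemma subspace_kernel: "subspace kernel"
  unfolding subspace_def kernel_def
  using graph_0 graph_add[of _ 0 _ 0] graph_scaleR[of _ 0] by auto

lemma closed_kernel: "closed kernel"
proof -
  have "closed ((\<lambda>x. (x, 0)) -` A)"
    by (intro closed_vimage closed_graph continuous_intros)
  then show ?thesis by (simp add: kernel_def vimage_def)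
qed

text \<open>
  Such a vector \<open>v\<close> is in the domain of the adjoint of \<open>A\<close>, with image \<open>0\<close>.
\<close>
lemma orthogonal_range_imp_kernel:
  assumes "\<And>x y. (x, y) \<in> A \<Longrightarrow> v \<bullet> y = 0"
  shows "v \<in> kernel"
  using assms unfolding kernel_def by (subst mem_Collect_eq, subst graph_iff) auto

text \<open>
  Positivity makes \<open>(x, y) \<mapsto> x + y\<close> bounded below on the graph, so the range of \<open>A + 1\<close> is
  closed; a vector orthogonal to it would be an eigenvector of \<open>A\<close> for the eigenvalue \<open>-1\<close>.
\<close>
lemma range_identity_plus: "\<exists>x. (x, u - x) \<in> A"
proof -
  define f where "f p = fst p + snd p" for p :: "'a \<times> 'a"
  have f: "bounded_linear f"
    unfolding f_def by (intro bounded_linear_add bounded_linear_fst bounded_linear_snd)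
  have "complete (f ` A)"
  proof (rule complete_isometric_image[OF zero_less_one subspace_graph f])
    show "complete A" using closed_graph by (simp add: complete_eq_closed)
    show "\<forall>p\<in>A. 1 * norm p \<le> norm (f p)"
    proof
      fix p assume "p \<in> A"
      then have "0 \<le> fst p \<bullet> snd p" using nonneg[of "fst p" "snd p"] by simp
      then have "(norm p)\<^sup>2 \<le> (norm (f p))\<^sup>2"
        unfolding power2_norm_eq_inner f_def
        by (simp add: inner_prod_def inner_add_left inner_add_right inner_commute)
      then have "norm p \<le> norm (f p)" by (rule power2_le_imp_le) simp
      then show "1 * norm p \<le> norm (f p)" by simp
    qed
  qed
  then have "closed (f ` A)" by (simp add: complete_eq_closed)
  moreover have "subspace (f ` A)"
    by (rule linear_subspace_image[OF bounded_linear.linear[OF f] subspace_graph])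
  ultimately obtain s where s: "s \<in> f ` A" "\<And>t. t \<in> f ` A \<Longrightarrow> t \<bullet> (u - s) = 0"
    using orthogonal_projection_exists by metis
  have "(u - s, - (u - s)) \<in> A"
  proof (subst graph_iff, safe)
    fix x w assume "(x, w) \<in> A"
    then have "(x + w) \<bullet> (u - s) = 0" using s(2)[of "x + w"] by (force simp: f_def)
    then have "(u - s) \<bullet> x + (u - s) \<bullet> w = 0" by (metis inner_add_right inner_commute)
    then show "(u - s) \<bullet> w = - (u - s) \<bullet> x" by (simp only: inner_minus_left)
  qed
  then have "0 \<le> (u - s) \<bullet> - (u - s)" by (rule nonneg)
  then have "(u - s) \<bullet> (u - s) \<le> 0" by (metis inner_minus_right neg_0_le_iff_le)
  then have "u = s" by (metis inner_gt_zero_iff not_le right_minus_eq)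
  then obtain x y where "(x, y) \<in> A" "u = x + y" using s(1) by (auto simp: f_def)
  then have "(x, u - x) \<in> A" by simp
  then show ?thesis ..
qed

lemma identity_plus_injective:
  assumes "(x, u - x) \<in> A" "(x', u - x') \<in> A"
  shows "x = x'"
proof -
  have "(x - x', - (x - x')) \<in> A" using graph_diff[OF assms] by simp
  then have "0 \<le> (x - x') \<bullet> - (x - x')" by (rule nonneg)
  then have "(x - x') \<bullet> (x - x') \<le> 0" by (metis inner_minus_right neg_0_le_iff_le)
  then show ?thesis by (metis inner_gt_zero_iff not_le right_minus_eq)
qed

text \<open>
  This is \<open>(A + 1)\<^sup>-\<^sup>1\<close>, and \<open>cayley\<close> below is \<open>(A - 1) (A + 1)\<^sup>-\<^sup>1\<close>.
\<close>
definition resolvent :: "'a \<Rightarrow> 'a" where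
  "resolvent u = (THE x. (x, u - x) \<in> A)"

lemma resolvent_graph: "(resolvent u, u - resolvent u) \<in> A"
  unfolding resolvent_def
proof (rule theI'[of "\<lambda>x. (x, u - x) \<in> A"])
  show "\<exists>!x. (x, u - x) \<in> A"
    using range_identity_plus[of u] identity_plus_injective[of _ u] by (elim exE) (rule ex1I)
qed

lemma resolvent_eqI: "(x, u - x) \<in> A \<Longrightarrow> resolvent u = x"
  by (rule identity_plus_injective[OF resolvent_graph])

lemma linear_resolvent: "linear resolvent"
proof (rule linearI)
  show "resolvent (u + v) = resolvent u + resolvent v" for u v
    using graph_add[OF resolvent_graph[of u] resolvent_graph[of v]]
    by (intro resolvent_eqI) (simp add: algebra_simps)
  show "resolvent (c *\<^sub>R u) = c *\<^sub>R resolvent u" for c u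
    using graph_scaleR[OF resolvent_graph[of u], of c]
    by (intro resolvent_eqI) (simp add: algebra_simps)
qed

lemma resolvent_symmetric: "resolvent u \<bullet> v = u \<bullet> resolvent v"
  using symmetric[OF resolvent_graph[of u] resolvent_graph[of v]]
  by (simp add: inner_diff_left inner_diff_right)

definition cayley :: "'a \<Rightarrow> 'a" where
  "cayley u = u - 2 *\<^sub>R resolvent u"

lemma cayley_symmetric_contraction: "symmetric_contraction cayley"
proof (rule symmetric_contraction.intro)
  show "linear cayley"
    unfolding cayley_def
    by (intro linear_compose_sub linear_compose_scale_right linear_resolvent linear_ident)
  show "cayley x \<bullet> y = x \<bullet> cayley y" for x y
    by (simp add: cayley_def inner_diff_left inner_diff_right resolvent_symmetric)
  show "norm (cayley x) \<le> norm x" for x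
  proof (rule power2_le_imp_le)
    show "(norm (cayley x))\<^sup>2 \<le> (norm x)\<^sup>2"
      using nonneg[OF resolvent_graph[of x]] unfolding power2_norm_eq_inner
      by (simp add: cayley_def inner_diff_left inner_diff_right inner_commute)
  qed simp
qed

sublocale cayley: symmetric_contraction cayley
  by (rule cayley_symmetric_contraction)

lemma cayley_kernel:
  assumes "k \<in> kernel"
  shows "cayley k = - k"
proof -
  have "resolvent k = k" using assms by (intro resolvent_eqI) (simp add: kernel_def)
  then show ?thesis by (simp add: cayley_def scaleR_2)
qed

lemma one_minus_cayley_squared:
  "w - cayley (cayley w) = 2 *\<^sub>R (2 *\<^sub>R resolvent (w - resolvent w))"
  by (simp add: cayley_def linear_diff[OF linear_resolvent] linear_add[OF linear_resolvent]
      scaleR_2 algebra_simps)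

text \<open>
  By symmetry \<open>(1 - C\<^sup>2) r = 0\<close>.  Up to the factor \<open>4\<close>, \<open>1 - C\<^sup>2\<close> is the resolvent composed with
  \<open>A (A + 1)\<^sup>-\<^sup>1\<close>; the resolvent is injective, so \<open>A (A + 1)\<^sup>-\<^sup>1 r = 0\<close> and \<open>r\<close> is in the kernel
  of \<open>A\<close>.
\<close>
lemma orthogonal_one_minus_cayley_squared:
  assumes "\<And>w. (w - cayley (cayley w)) \<bullet> r = 0"
  shows "r \<in> kernel"
proof -
  have "w \<bullet> (r - cayley (cayley r)) = 0" for w
    using assms[of w] by (simp add: inner_diff_left inner_diff_right cayley.symmetric)
  then have "r - cayley (cayley r) = 0" by (metis inner_eq_zero_iff)
  then have "resolvent (r - resolvent r) = 0" by (simp add: one_minus_cayley_squared)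
  then have "r - resolvent r = 0"
    using resolvent_graph[of "r - resolvent r"] image_0[of "r - resolvent r"] by simp
  then show ?thesis using resolvent_graph[of r] by (simp add: kernel_def)
qed

lemma dense_kernel_plus_range:
  "closure {k + (w - cayley (cayley w)) | k w. k \<in> kernel} = UNIV" (is "closure ?L = UNIV")
proof -
  have sub: "subspace ?L"
  proof -
    have "linear (\<lambda>w. w - cayley (cayley w))"
      using linear_compose[OF cayley.linear cayley.linear]
      by (intro linear_compose_sub linear_ident) (simp add: o_def)
    then have "subspace (range (\<lambda>w. w - cayley (cayley w)))"
      by (simp add: linear_subspace_image)
    from subspace_sums[OF subspace_kernel this]
    show ?thesis by (simp add: image_def) (smt (verit) Collect_cong)
  qed
  have "u \<in> closure ?L" for u
  proof -
    obtain p where p: "p \<in> closure ?L" "\<And>s. s \<in> closure ?L \<Longrightarrow> s \<bullet> (u - p) = 0"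
      using orthogonal_projection_exists[OF subspace_closure[OF sub] closed_closure, of u] by blast
    have orth: "s \<bullet> (u - p) = 0" if "s \<in> ?L" for s
      using p(2) subsetD[OF closure_subset that] .
    have "(w - cayley (cayley w)) \<bullet> (u - p) = 0" for w
    proof (rule orth)
      have "w - cayley (cayley w) = 0 + (w - cayley (cayley w))" by simp
      then show "w - cayley (cayley w) \<in> ?L" using subspace_0[OF subspace_kernel] by blast
    qed
    then have "u - p \<in> kernel" by (rule orthogonal_one_minus_cayley_squared)
    moreover have "(u - p) \<bullet> (u - p) = 0" if "u - p \<in> kernel"
    proof (rule orth)
      have "cayley 0 = 0" using linear_0[OF cayley.linear] .
      then have "u - p = (u - p) + (0 - cayley (cayley 0))" by simp
      then show "u - p \<in> ?L" using that by blast
    qed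
    ultimately have "u = p" by simp
    then show ?thesis using p(1) by simp
  qed
  then show ?thesis by blast
qed

section \<open>The Lyapunov inequality\<close>

text \<open>
  With \<open>u = x + y\<close> and \<open>cayley u = y - x\<close>, the diagonal terms of the two quadratic expressions
  cancel and the mixed terms add up.
\<close>
lemma cayley_step:
  assumes "linear B"
  obtains x y where "(x, y) \<in> A" "u = x + y"
    "u \<bullet> B u = cayley u \<bullet> B (cayley u) + 2 * (x \<bullet> B y + y \<bullet> B x)"
proof -
  define x y where "x = resolvent u" and "y = u - resolvent u"
  have xy: "(x, y) \<in> A" by (simp add: x_def y_def resolvent_graph)
  have u: "u = x + y" and c: "cayley u = y - x"
    by (simp_all add: x_def y_def cayley_def scaleR_2)
  have "u \<bullet> B u = cayley u \<bullet> B (cayley u) + 2 * (x \<bullet> B y + y \<bullet> B x)"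
    unfolding c unfolding u
    by (simp add: linear_add[OF assms(1)] linear_diff[OF assms(1)]
        inner_add_left inner_add_right inner_diff_left inner_diff_right)
  with xy u show ?thesis by (rule that)
qed

lemma lyapunov_nonneg:
  assumes B: "bounded_linear B"
    and ker: "\<And>k. k \<in> kernel \<Longrightarrow> B k = 0"
    and lyap: "\<And>x y. (x, y) \<in> A \<Longrightarrow> x \<bullet> B y + y \<bullet> B x \<ge> 0"
  shows "u \<bullet> B u \<ge> 0"
proof -
  interpret B: bounded_linear B by fact
  have step: "cayley v \<bullet> B (cayley v) \<le> v \<bullet> B v" for v
    by (rule cayley_step[OF B.linear, of v]) (use lyap in force)
  have cont: "continuous_on UNIV (\<lambda>v. v \<bullet> B v)"
    by (intro continuous_intros linear_continuous_on B)
  have *: "v \<bullet> B v \<ge> 0" if "k \<in> kernel" and v: "v = k + (w - cayley (cayley w))" for v k w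
  proof -
    define e where "e n = (cayley ^^ n) (w - cayley (cayley w))" for n
    have e0: "e \<longlonglongrightarrow> 0" unfolding e_def by (rule cayley.powers_tendsto_0)
    have pow: "(cayley ^^ n) v = (-1) ^ n *\<^sub>R k + e n" for n
    proof (induction n)
      case 0
      then show ?case by (simp add: e_def v)
    next
      case (Suc n)
      then show ?case
        by (simp add: e_def linear_add[OF cayley.linear] linear_scale[OF cayley.linear]
            linear_neg[OF cayley.linear] cayley_kernel[OF that(1)])
    qed
    \<comment> \<open>The term with \<open>B k\<close> vanishes, and every term left contains \<open>e n\<close>.\<close>
    define f where "f n = ((-1) ^ n *\<^sub>R k) \<bullet> B (e n) + e n \<bullet> B (e n)" for n
    have f: "(cayley ^^ n) v \<bullet> B ((cayley ^^ n) v) = f n" for n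
      by (simp add: f_def pow B.add B.scaleR ker[OF that(1)] inner_add_left)
    have decr: "f n \<le> v \<bullet> B v" for n
    proof (induction n)
      case 0
      then show ?case using f[of 0] by simp
    next
      case (Suc n)
      then show ?case using f[of "Suc n"] f[of n] step[of "(cayley ^^ n) v"] by simp
    qed
    have Be: "(\<lambda>n. B (e n)) \<longlonglongrightarrow> 0"
      using B.tendsto[OF e0] by (simp add: B.zero)
    have "(\<lambda>n. k \<bullet> B (e n)) \<longlonglongrightarrow> 0"
      using tendsto_inner[OF tendsto_const Be, of k] by simp
    then have "(\<lambda>n. (-1) ^ n * (k \<bullet> B (e n))) \<longlonglongrightarrow> 0"
      by (rule Lim_null_comparison[rotated, OF tendsto_rabs_zero]) (simp add: abs_mult power_abs)
    moreover have "(\<lambda>n. e n \<bullet> B (e n)) \<longlonglongrightarrow> 0"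
      using tendsto_inner[OF e0 Be] by simp
    ultimately have "f \<longlonglongrightarrow> 0"
      unfolding f_def using tendsto_add by fastforce
    then show ?thesis by (rule LIMSEQ_le_const2) (use decr in blast)
  qed
  have "u \<in> closure {k + (w - cayley (cayley w)) | k w. k \<in> kernel}"
    unfolding dense_kernel_plus_range by simp
  also have "closure {k + (w - cayley (cayley w)) | k w. k \<in> kernel} \<subseteq> {v. 0 \<le> v \<bullet> B v}"
  proof (rule closure_minimal)
    show "closed {v. 0 \<le> v \<bullet> B v}"
      by (intro closed_Collect_le cont continuous_intros)
  qed (use * in auto)
  finally show ?thesis by simp
qed

text \<open>
  One Cayley step strictly decreases the quadratic form, and after it the form is still
  nonnegative by \<open>lyapunov_nonneg\<close>.
\<close>
lemma lyapunov_pos: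
  assumes B: "bounded_linear B"
    and ker: "\<And>k. k \<in> kernel \<Longrightarrow> B k = 0"
    and lyap: "\<And>x y. (x, y) \<in> A \<Longrightarrow> x \<noteq> 0 \<Longrightarrow> x \<bullet> B y + y \<bullet> B x > 0"
    and "u \<noteq> 0"
  shows "u \<bullet> B u > 0"
proof -
  interpret B: bounded_linear B by fact
  have nonneg: "v \<bullet> B v \<ge> 0" for v
  proof (rule lyapunov_nonneg[OF B ker])
    show "0 \<le> x \<bullet> B y + y \<bullet> B x" if "(x, y) \<in> A" for x y
      using lyap[OF that] image_0[of y] that by (cases "x = 0") (auto simp: B.zero)
  qed
  obtain x y where xy: "(x, y) \<in> A" "u = x + y"
    and step: "u \<bullet> B u = cayley u \<bullet> B (cayley u) + 2 * (x \<bullet> B y + y \<bullet> B x)"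
    by (rule cayley_step[OF B.linear])
  have "x \<noteq> 0" using xy image_0 \<open>u \<noteq> 0\<close> by auto
  from lyap[OF xy(1) this] show ?thesis
    unfolding step using nonneg[of "cayley u"] by (simp add: add_nonneg_pos)
qed

end

section \<open>The polar decomposition\<close>

text \<open>
  The partial isometry of the polar decomposition of \<open>T = W A\<close>: it vanishes exactly on the kernel
  of \<open>A\<close> and is isometric on its orthogonal complement.
\<close>
locale polar = positive_self_adjoint A
  for A :: "('a :: {real_inner, complete_space} \<times> 'a) set" +
  fixes W :: "'a \<Rightarrow> 'a"
  assumes bounded_linear_W: "bounded_linear W"
    and kernel_W: "W k = 0 \<longleftrightarrow> k \<in> kernel"
    and isometric_W: "(\<And>k. k \<in> kernel \<Longrightarrow> k \<bullet> x = 0) \<Longrightarrow> norm (W x) = norm x"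
begin

sublocale W: bounded_linear W
  by (rule bounded_linear_W)

lemma kernel_decomposition:
  obtains k x' where "x = k + x'" "k \<in> kernel" "\<And>l. l \<in> kernel \<Longrightarrow> l \<bullet> x' = 0"
proof -
  obtain p where "p \<in> kernel" "\<And>s. s \<in> kernel \<Longrightarrow> s \<bullet> (x - p) = 0"
    using orthogonal_projection_exists[OF subspace_kernel closed_kernel] by metis
  then show ?thesis using that[of p "x - p"] by simp
qed

lemma inner_W:
  assumes x: "\<And>k. k \<in> kernel \<Longrightarrow> k \<bullet> x = 0"
  shows "W x \<bullet> W z = x \<bullet> z"
proof -
  obtain k z' where z: "z = k + z'" "k \<in> kernel" and z': "\<And>l. l \<in> kernel \<Longrightarrow> l \<bullet> z' = 0"
    using kernel_decomposition[of z] by blast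
  \<comment> \<open>\<open>x\<close>, \<open>z'\<close> and \<open>x + z'\<close> are all orthogonal to the kernel, so polarization applies.\<close>
  have "(norm (W x + W z'))\<^sup>2 = (norm (x + z'))\<^sup>2"
    using isometric_W[of "x + z'"] x z' by (simp add: inner_add_right W.add)
  moreover have "(norm (W x))\<^sup>2 = (norm x)\<^sup>2" "(norm (W z'))\<^sup>2 = (norm z')\<^sup>2"
    using isometric_W x z' by simp_all
  ultimately have "W x \<bullet> W z' = x \<bullet> z'"
    unfolding power2_norm_eq_inner
    by (simp add: inner_add_left inner_add_right inner_commute)
  moreover have "W z = W z'" "x \<bullet> z = x \<bullet> z'"
    using z x[of k] kernel_W[of k] by (simp_all add: W.add inner_add_right inner_commute)
  ultimately show ?thesis by simp
qed

text \<open>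
  The adjoint of \<open>T = W A\<close>.
\<close>
definition adjoint_graph :: "('a \<times> 'a) set" where
  "adjoint_graph = {(v, z). \<forall>(x, y) \<in> A. v \<bullet> W y = z \<bullet> x}"

lemma adjoint_graph_W:
  assumes "(x, y) \<in> A" "\<And>k. k \<in> kernel \<Longrightarrow> k \<bullet> x = 0"
  shows "(W x, y) \<in> adjoint_graph"
  using assms(2) symmetric[OF assms(1)] by (auto simp: adjoint_graph_def inner_W)

text \<open>
  The range of \<open>W\<close> is closed, being the isometric image of the orthogonal complement of the
  kernel.
\<close>
lemma range_decomposition:
  obtains y\<^sub>0 x where "v = y\<^sub>0 + W x" "\<And>z. y\<^sub>0 \<bullet> W z = 0" "\<And>k. k \<in> kernel \<Longrightarrow> k \<bullet> x = 0"
proof -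
  define N where "N = {x. \<forall>k\<in>kernel. k \<bullet> x = 0}"
  have sub: "subspace N" by (auto simp: N_def subspace_def inner_add_right)
  have "N = (\<Inter>k\<in>kernel. {x. k \<bullet> x = 0})" by (auto simp: N_def)
  also have "closed \<dots>" by (intro closed_INT ballI closed_Collect_eq continuous_intros)
  finally have "complete N" by (simp add: complete_eq_closed)
  then have "complete (W ` N)"
    by (intro complete_isometric_image[OF zero_less_one sub bounded_linear_W])
      (auto simp: N_def isometric_W)
  then have "closed (W ` N)" by (simp add: complete_eq_closed)
  moreover have "subspace (W ` N)" using sub W.linear by (rule linear_subspace_image[rotated])
  ultimately obtain p where p: "p \<in> W ` N" "\<And>s. s \<in> W ` N \<Longrightarrow> s \<bullet> (v - p) = 0"
    using orthogonal_projection_exists by metis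
  then obtain x where x: "x \<in> N" "p = W x" by blast
  have "(v - p) \<bullet> W z = 0" for z
  proof -
    obtain k z' where z: "z = k + z'" "k \<in> kernel" "\<And>l. l \<in> kernel \<Longrightarrow> l \<bullet> z' = 0"
      using kernel_decomposition by blast
    then have "W z = W z'" using kernel_W[of k] by (simp add: W.add)
    moreover have "W z' \<in> W ` N" using z(3) by (auto simp: N_def)
    ultimately show ?thesis using p(2)[of "W z'"] by (simp add: inner_commute)
  qed
  then show ?thesis using that[of "v - p" x] x by (simp add: N_def)
qed

text \<open>
  Removing from \<open>x\<close> its component in the kernel of \<open>A\<close> changes neither \<open>W x\<close> nor the image
  \<open>y\<close> of \<open>x\<close> under \<open>A\<close>, and then \<open>(W x, y)\<close> is in the graph of the adjoint of \<open>T\<close>.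
\<close>
lemma product_lyapunov:
  assumes G: "bounded_linear G"
    and adj: "\<And>v z. (v, z) \<in> adjoint_graph \<Longrightarrow> G v \<bullet> z \<ge> 0"
    and xy: "(x, y) \<in> A"
  shows "y \<bullet> G (W x) \<ge> 0"
proof -
  obtain k x' where x: "x = k + x'" "k \<in> kernel" "\<And>l. l \<in> kernel \<Longrightarrow> l \<bullet> x' = 0"
    using kernel_decomposition by blast
  have "(x', y) \<in> A" using graph_diff[OF xy, of k 0] x by (simp add: kernel_def)
  then have "0 \<le> G (W x') \<bullet> y" using adj adjoint_graph_W x(3) by blast
  moreover have "W x = W x'" using x kernel_W[of k] by (simp add: W.add)
  ultimately show ?thesis by (simp add: inner_commute)
qed

lemma bounded_linear_GW: "bounded_linear G \<Longrightarrow> bounded_linear (\<lambda>x. G (W x))"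
  using bounded_linear_compose[OF _ bounded_linear_W] .

lemma GW_nonneg:
  assumes G: "bounded_linear G"
    and fwd: "\<And>x y. (x, y) \<in> A \<Longrightarrow> x \<bullet> G (W y) \<ge> 0"
    and adj: "\<And>v z. (v, z) \<in> adjoint_graph \<Longrightarrow> G v \<bullet> z \<ge> 0"
  shows "u \<bullet> G (W u) \<ge> 0"
proof (rule lyapunov_nonneg[OF bounded_linear_GW[OF G]])
  interpret G: bounded_linear G by fact
  show "G (W k) = 0" if "k \<in> kernel" for k
    using that kernel_W[of k] by (simp add: G.zero)
  show "0 \<le> x \<bullet> G (W y) + y \<bullet> G (W x)" if "(x, y) \<in> A" for x y
    using fwd[OF that] product_lyapunov[OF G adj that] by linarith
qed

lemma GW_pos:
  assumes G: "bounded_linear G"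
    and fwd: "\<And>x y. (x, y) \<in> A \<Longrightarrow> x \<noteq> 0 \<Longrightarrow> x \<bullet> G (W y) > 0"
    and adj: "\<And>v z. (v, z) \<in> adjoint_graph \<Longrightarrow> G v \<bullet> z \<ge> 0"
    and "u \<noteq> 0"
  shows "u \<bullet> G (W u) > 0"
proof (rule lyapunov_pos[OF bounded_linear_GW[OF G] _ _ \<open>u \<noteq> 0\<close>])
  interpret G: bounded_linear G by fact
  show "G (W k) = 0" if "k \<in> kernel" for k
    using that kernel_W[of k] by (simp add: G.zero)
  show "0 < x \<bullet> G (W y) + y \<bullet> G (W x)" if "(x, y) \<in> A" "x \<noteq> 0" for x y
    using fwd[OF that] product_lyapunov[OF G adj that(1)] by linarith
qed

text \<open>
  Adding a multiple of \<open>y\<^sub>0\<close> to a vector does not change its image under the adjoint of \<open>T\<close>.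
  The accretivity inequality thus bounds below an affine function of \<open>t\<close>, whose slope
  \<open>G y\<^sub>0 \<bullet> y\<close> must vanish.
\<close>
lemma G_cokernel:
  assumes G: "bounded_linear G"
    and adj: "\<And>v z. (v, z) \<in> adjoint_graph \<Longrightarrow> G v \<bullet> z \<ge> 0"
    and y\<^sub>0: "\<And>z. y\<^sub>0 \<bullet> W z = 0"
  shows "G y\<^sub>0 \<in> kernel"
proof (rule orthogonal_range_imp_kernel)
  interpret G: bounded_linear G by fact
  fix x y assume xy: "(x, y) \<in> A"
  obtain k x' where x: "x = k + x'" "k \<in> kernel" "\<And>l. l \<in> kernel \<Longrightarrow> l \<bullet> x' = 0"
    using kernel_decomposition by blast
  have "(x', y) \<in> A" using graph_diff[OF xy, of k 0] x by (simp add: kernel_def)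
  then have *: "(W x', y) \<in> adjoint_graph" using adjoint_graph_W x(3) by blast
  have ge: "0 \<le> G (W x') \<bullet> y + t * (G y\<^sub>0 \<bullet> y)" for t
  proof -
    have "(W x' + t *\<^sub>R y\<^sub>0, y) \<in> adjoint_graph"
      using * by (auto simp: adjoint_graph_def inner_add_left y\<^sub>0)
    from adj[OF this] show ?thesis by (simp add: G.add G.scaleR inner_add_left)
  qed
  show "G y\<^sub>0 \<bullet> y = 0"
  proof (rule ccontr)
    assume ne: "G y\<^sub>0 \<bullet> y \<noteq> 0"
    \<comment> \<open>At this value of \<open>t\<close> the affine function equals \<open>-1\<close>.\<close>
    show False using ge[of "- (G (W x') \<bullet> y + 1) / (G y\<^sub>0 \<bullet> y)"] ne by simp
  qed
qed

lemma inner_WG_eq_inner_GW: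
  assumes G: "bounded_linear G"
    and adj: "\<And>v z. (v, z) \<in> adjoint_graph \<Longrightarrow> G v \<bullet> z \<ge> 0"
    and y\<^sub>0: "\<And>z. y\<^sub>0 \<bullet> W z = 0"
    and x: "\<And>k. k \<in> kernel \<Longrightarrow> k \<bullet> x = 0"
  shows "(y\<^sub>0 + W x) \<bullet> W (G (y\<^sub>0 + W x)) = x \<bullet> G (W x)"
proof -
  interpret G: bounded_linear G by fact
  have "(y\<^sub>0 + W x) \<bullet> W (G (y\<^sub>0 + W x)) = x \<bullet> G (y\<^sub>0 + W x)"
    by (simp add: inner_add_left y\<^sub>0 inner_W[OF x])
  also have "\<dots> = G y\<^sub>0 \<bullet> x + x \<bullet> G (W x)"
    by (simp add: G.add inner_add_right inner_commute)
  also have "G y\<^sub>0 \<bullet> x = 0" by (intro x G_cokernel[OF G adj y\<^sub>0])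
  finally show ?thesis by simp
qed

lemma WG_nonneg:
  assumes G: "bounded_linear G"
    and fwd: "\<And>x y. (x, y) \<in> A \<Longrightarrow> x \<bullet> G (W y) \<ge> 0"
    and adj: "\<And>v z. (v, z) \<in> adjoint_graph \<Longrightarrow> G v \<bullet> z \<ge> 0"
  shows "v \<bullet> W (G v) \<ge> 0"
proof -
  obtain y\<^sub>0 x where v: "v = y\<^sub>0 + W x" "\<And>z. y\<^sub>0 \<bullet> W z = 0" "\<And>k. k \<in> kernel \<Longrightarrow> k \<bullet> x = 0"
    by (rule range_decomposition) blast
  then have "v \<bullet> W (G v) = x \<bullet> G (W x)"
    using inner_WG_eq_inner_GW[OF G adj] by blast
  then show ?thesis using GW_nonneg[OF G fwd adj] by simp
qed

lemma WG_pos: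
  assumes G: "bounded_linear G"
    and fwd: "\<And>x y. (x, y) \<in> A \<Longrightarrow> x \<noteq> 0 \<Longrightarrow> x \<bullet> G (W y) > 0"
    and adj: "\<And>v z. (v, z) \<in> adjoint_graph \<Longrightarrow> v \<noteq> 0 \<Longrightarrow> G v \<bullet> z > 0"
    and "v \<noteq> 0"
  shows "v \<bullet> W (G v) > 0"
proof -
  interpret G: bounded_linear G by fact
  obtain y\<^sub>0 x where v: "v = y\<^sub>0 + W x" "\<And>z. y\<^sub>0 \<bullet> W z = 0" "\<And>k. k \<in> kernel \<Longrightarrow> k \<bullet> x = 0"
    by (rule range_decomposition) blast
  have "(y\<^sub>0, 0) \<in> adjoint_graph" using v(2) by (auto simp: adjoint_graph_def)
  \<comment> \<open>Strictness of the adjoint hypothesis means in particular that the adjoint of \<open>T\<close> is injective.\<close>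
  then have "y\<^sub>0 = 0" using adj[of y\<^sub>0 0] by auto
  then have "x \<noteq> 0" using v(1) \<open>v \<noteq> 0\<close> by (auto simp: W.zero)
  have adj': "G v \<bullet> z \<ge> 0" if "(v, z) \<in> adjoint_graph" for v z
    using adj[OF that] by (cases "v = 0") (auto simp: G.zero)
  have "v \<bullet> W (G v) = x \<bullet> G (W x)"
    using inner_WG_eq_inner_GW[OF G adj' v(2,3)] v(1) by simp
  then show ?thesis using GW_pos[OF G fwd adj' \<open>x \<noteq> 0\<close>] by simp
qed

end

section \<open>Passage to the real inner product\<close>

lemma Im_cinner:
  fixes x y :: "'a :: complex_hilbert_space"
  shows "Im (cinner x y) = (\<i> *\<^sub>C x) \<bullet> y"
  using cinner_commute[of "\<i> *\<^sub>C x" y] cinner_commute[of y x]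
  by (simp add: inner_eq_Re_cinner cinner_scaleC_right)

lemma linear_operator_scaleR:
  "linear_operator T \<Longrightarrow> (x, y) \<in> T \<Longrightarrow> (c *\<^sub>R x, c *\<^sub>R y) \<in> T"
  unfolding linear_operator_def by (metis scaleC_of_real)

text \<open>
  The graph of a linear operator is invariant under multiplication by \<open>\<i>\<close>, so the real parts of
  the defining equations determine the imaginary parts.
\<close>
lemma op_adjoint_iff_inner:
  assumes "linear_operator T"
  shows "(y, z) \<in> op_adjoint T \<longleftrightarrow> (\<forall>(x, w) \<in> T. y \<bullet> w = z \<bullet> x)"
proof
  assume "(y, z) \<in> op_adjoint T"
  then show "\<forall>(x, w) \<in> T. y \<bullet> w = z \<bullet> x"
    by (auto simp: op_adjoint_def inner_eq_Re_cinner)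
next
  assume *: "\<forall>(x, w) \<in> T. y \<bullet> w = z \<bullet> x"
  have "cinner y w = cinner z x" if "(x, w) \<in> T" for x w
  proof (rule complex_eqI)
    show "Re (cinner y w) = Re (cinner z x)"
      using * that by (auto simp: inner_eq_Re_cinner)
    have "(\<i> *\<^sub>C x, \<i> *\<^sub>C w) \<in> T"
      using assms that by (simp add: linear_operator_def)
    then have "y \<bullet> (\<i> *\<^sub>C w) = z \<bullet> (\<i> *\<^sub>C x)" using * by auto
    then show "Im (cinner y w) = Im (cinner z x)"
      by (simp add: inner_eq_Re_cinner cinner_scaleC_right)
  qed
  then show "(y, z) \<in> op_adjoint T" by (auto simp: op_adjoint_def)
qed

lemma bounded_operator_function:
  assumes "bounded_operator G"
  obtains g where "bounded_linear g" "\<And>x y. (x, y) \<in> G \<longleftrightarrow> y = g x"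
proof -
  have lin: "linear_operator G" and dom: "Domain G = UNIV"
    and "\<exists>K. \<forall>(x, y) \<in> G. norm y \<le> K * norm x"
    using assms by (auto simp: bounded_operator_def)
  then obtain K where K: "\<And>x y. (x, y) \<in> G \<Longrightarrow> norm y \<le> K * norm x" by blast
  define g where "g x = (SOME y. (x, y) \<in> G)" for x
  have g: "(x, g x) \<in> G" for x
    unfolding g_def by (rule someI_ex) (use dom in blast)
  have iff: "(x, y) \<in> G \<longleftrightarrow> y = g x" for x y
    using g lin by (auto simp: linear_operator_def single_valued_def)
  have "bounded_linear g"
  proof (rule bounded_linear_intro[of _ K])
    show "g (x + y) = g x + g y" for x y
      using g lin by (metis iff linear_operator_def)
    show "g (c *\<^sub>R x) = c *\<^sub>R g x" for c x
      using linear_operator_scaleR[OF lin g] by (simp add: iff)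
    show "norm (g x) \<le> norm x * K" for x
      using K[OF g, of x] by (simp add: mult.commute)
  qed
  then show ?thesis using that iff by blast
qed

text \<open>
  Without this the domain of \<open>G\<^sup>* T\<^sup>*\<close> could be smaller than that of \<open>T\<^sup>*\<close>, and its accretivity
  would say nothing about the remaining vectors.
\<close>
lemma adjoint_total:
  assumes "bounded_operator G"
  shows "\<exists>z. (w, z) \<in> op_adjoint G"
proof -
  obtain g where g: "bounded_linear g" "\<And>x y. (x, y) \<in> G \<longleftrightarrow> y = g x"
    using bounded_operator_function[OF assms] by blast
  have lin: "linear_operator G" using assms by (simp add: bounded_operator_def)
  have "bounded_linear (\<lambda>x. w \<bullet> g x)"
    using bounded_linear_compose[OF bounded_linear_inner_right g(1)] .
  then obtain z where "\<forall>x. w \<bullet> g x = z \<bullet> x" using riesz_representation by blast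
  then show ?thesis using g(2) by (auto simp: op_adjoint_iff_inner[OF lin])
qed

lemma accretive_iff:
  assumes scale: "\<forall>c. \<forall>(x, y) \<in> T. (c *\<^sub>R x, c *\<^sub>R y) \<in> T"
  shows "accretive T \<longleftrightarrow> (\<forall>(x, y) \<in> T. 0 \<le> x \<bullet> y)"
    and "strictly_accretive T \<longleftrightarrow> (\<forall>(x, y) \<in> T. x \<noteq> 0 \<longrightarrow> 0 < x \<bullet> y)"
proof -
  have unit: "\<exists>x' y'. (x', y') \<in> T \<and> norm x' = 1 \<and> x \<bullet> y = (norm x)\<^sup>2 * (x' \<bullet> y')"
    if "(x, y) \<in> T" "x \<noteq> 0" for x y
    using scale[rule_format, OF that(1), of "1 / norm x"] that(2)
    by (intro exI[of _ "(1 / norm x) *\<^sub>R x"] exI[of _ "(1 / norm x) *\<^sub>R y"])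
      (simp add: power2_eq_square)
  show "accretive T \<longleftrightarrow> (\<forall>(x, y) \<in> T. 0 \<le> x \<bullet> y)"
  proof (intro iffI)
    assume acc: "accretive T"
    have "0 \<le> x \<bullet> y" if "(x, y) \<in> T" for x y
    proof (cases "x = 0")
      case False
      then obtain x' y' where "(x', y') \<in> T" "norm x' = 1" "x \<bullet> y = (norm x)\<^sup>2 * (x' \<bullet> y')"
        using unit \<open>(x, y) \<in> T\<close> by blast
      then show ?thesis using acc by (auto simp: accretive_def inner_eq_Re_cinner)
    qed simp
    then show "\<forall>(x, y) \<in> T. 0 \<le> x \<bullet> y" by blast
  qed (auto simp: accretive_def inner_eq_Re_cinner)
  show "strictly_accretive T \<longleftrightarrow> (\<forall>(x, y) \<in> T. x \<noteq> 0 \<longrightarrow> 0 < x \<bullet> y)"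
  proof (intro iffI)
    assume acc: "strictly_accretive T"
    have "0 < x \<bullet> y" if "(x, y) \<in> T" "x \<noteq> 0" for x y
    proof -
      obtain x' y' where "(x', y') \<in> T" "norm x' = 1" "x \<bullet> y = (norm x)\<^sup>2 * (x' \<bullet> y')"
        using unit \<open>(x, y) \<in> T\<close> \<open>x \<noteq> 0\<close> by blast
      then show ?thesis
        using acc \<open>x \<noteq> 0\<close> by (auto simp: strictly_accretive_def inner_eq_Re_cinner)
    qed
    then show "\<forall>(x, y) \<in> T. x \<noteq> 0 \<longrightarrow> 0 < x \<bullet> y" by blast
  qed (force simp: strictly_accretive_def inner_eq_Re_cinner)
qed

lemma positive_self_adjointI:
  assumes "self_adjoint A" "positive_operator A"
  shows "positive_self_adjoint A"
proof
  have lin: "linear_operator A" and adj: "op_adjoint A = A"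
    using assms(1) by (auto simp: self_adjoint_def)
  show "(y, z) \<in> A \<longleftrightarrow> (\<forall>(x, w) \<in> A. y \<bullet> w = z \<bullet> x)" for y z
    using op_adjoint_iff_inner[OF lin, of y z] adj by simp
  show "0 \<le> x \<bullet> y" if "(x, y) \<in> A" for x y
    using assms(2) that
    by (auto simp: positive_operator_def inner_eq_Re_cinner complex_nonneg_Reals_iff)
  show "y = 0" if "(0, y) \<in> A" for y
    using lin that by (auto simp: linear_operator_def single_valued_def)
qed

text \<open>
  If \<open>T x = 0\<close> then \<open>A (A x) = T\<^sup>* (T x) = 0\<close>, hence \<open>\<parallel>A x\<parallel>\<^sup>2 = \<langle>x, A (A x)\<rangle> = 0\<close>.
\<close>
lemma modulus_kernel:
  assumes "linear_operator T" "is_modulus A T" "T = W \<cdot> A" "bounded_operator W"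
  shows "(x, 0) \<in> T \<longleftrightarrow> (x, 0) \<in> A"
proof
  interpret positive_self_adjoint A
    using assms(2) by (intro positive_self_adjointI) (auto simp: is_modulus_def)
  assume "(x, 0) \<in> T"
  moreover have "(0, 0) \<in> op_adjoint T"
    by (simp add: op_adjoint_iff_inner[OF assms(1)] case_prod_beta)
  ultimately have "(x, 0) \<in> op_adjoint T \<cdot> T" by (auto simp: op_mult_def)
  then have "(x, 0) \<in> A \<cdot> A" using assms(2) by (simp add: is_modulus_def)
  then obtain y where y: "(x, y) \<in> A" "(y, 0) \<in> A" by (auto simp: op_mult_def)
  have "y \<bullet> y = 0" using symmetric[OF y] by simp
  then show "(x, 0) \<in> A" using y(1) by simp
next
  assume "(x, 0) \<in> A"
  moreover have "(0, 0) \<in> W" using assms(4) by (simp add: bounded_operator_def linear_operator_def)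
  ultimately show "(x, 0) \<in> T" using assms(3) by (auto simp: op_mult_def)
qed

lemma polarI:
  assumes lin: "linear_operator T" and pd: "polar_decomposition T W A"
    and w: "bounded_linear w" "\<And>x y. (x, y) \<in> W \<longleftrightarrow> y = w x"
  shows "polar A w"
proof -
  have mod: "is_modulus A T" and pi: "partial_isometry W" and T: "T = W \<cdot> A"
    and ker: "op_ker W = op_ker T"
    using pd by (auto simp: polar_decomposition_def)
  interpret positive_self_adjoint A
    using mod by (intro positive_self_adjointI) (auto simp: is_modulus_def)
  have bW: "bounded_operator W" using pi by (simp add: partial_isometry_def)
  have "op_ker W = kernel"
    using modulus_kernel[OF lin mod T bW] ker by (simp add: op_ker_def kernel_def)
  show ?thesis
  proof (intro polar.intro polar_axioms.intro)
    show "positive_self_adjoint A" by (rule positive_self_adjoint_axioms)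
    show "w k = 0 \<longleftrightarrow> k \<in> kernel" for k
      using \<open>op_ker W = kernel\<close> w(2)[of k 0] by (auto simp: op_ker_def)
    show "norm (w x) = norm x" if x: "\<And>k. k \<in> kernel \<Longrightarrow> k \<bullet> x = 0" for x
    proof -
      have "cinner k x = 0" if "k \<in> op_ker W" for k
      proof (rule complex_eqI)
        have "(\<i> *\<^sub>C k, \<i> *\<^sub>C 0) \<in> W"
          using that bW by (auto simp: op_ker_def bounded_operator_def linear_operator_def)
        moreover have "\<i> *\<^sub>C (0 :: 'a) = 0"
          using scaleC_add_right[of \<i> "0 :: 'a" 0] by simp
        ultimately have "\<i> *\<^sub>C k \<in> op_ker W" by (simp add: op_ker_def)
        then show "Im (cinner k x) = Im 0"
          using x \<open>op_ker W = kernel\<close> by (simp add: Im_cinner)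
        show "Re (cinner k x) = Re 0"
          using x that \<open>op_ker W = kernel\<close> by (simp add: inner_eq_Re_cinner)
      qed
      then show ?thesis using pi w(2)[of x "w x"] by (auto simp: partial_isometry_def)
    qed
  qed (rule w(1))
qed

theorem theorem4:
  fixes T W A G :: "'a :: complex_hilbert_space operator"
  assumes "closed_operator T" and "densely_defined T"
    and "polar_decomposition T W A"
    and "bounded_operator G"
  shows "(accretive (G \<cdot> T) \<and> accretive (op_adjoint G \<cdot> op_adjoint T) \<longrightarrow>
            accretive (G \<cdot> W) \<and> accretive (W \<cdot> G)) \<and>
         (strictly_accretive (G \<cdot> T) \<and> strictly_accretive (op_adjoint G \<cdot> op_adjoint T) \<longrightarrow>
            strictly_accretive (G \<cdot> W) \<and> strictly_accretive (W \<cdot> G))"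
proof -
  have linT: "linear_operator T" using assms(1) by (simp add: closed_operator_def)
  have T: "T = W \<cdot> A" and bW: "bounded_operator W"
    using assms(3) by (auto simp: polar_decomposition_def partial_isometry_def)
  have linG: "linear_operator G" and linW: "linear_operator W"
    using assms(4) bW by (auto simp: bounded_operator_def)
  obtain w where w: "bounded_linear w" "\<And>x y. (x, y) \<in> W \<longleftrightarrow> y = w x"
    using bounded_operator_function[OF bW] by blast
  obtain g where g: "bounded_linear g" "\<And>x y. (x, y) \<in> G \<longleftrightarrow> y = g x"
    using bounded_operator_function[OF assms(4)] by blast
  interpret polar A w by (rule polarI[OF linT assms(3) w])
  have T_iff: "(x, y) \<in> T \<longleftrightarrow> (\<exists>z. (x, z) \<in> A \<and> y = w z)" for x y
    by (auto simp: T op_mult_def w(2))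
  have adjT: "(v, z) \<in> op_adjoint T \<longleftrightarrow> (v, z) \<in> adjoint_graph" for v z
    unfolding op_adjoint_iff_inner[OF linT] adjoint_graph_def
    by (auto simp: Ball_def T_iff)
  have adjGT: "\<exists>u. (v, u) \<in> op_adjoint G \<cdot> op_adjoint T \<and> v \<bullet> u = g v \<bullet> z"
    if vz: "(v, z) \<in> adjoint_graph" for v z
  proof -
    obtain u where u: "(z, u) \<in> op_adjoint G" using adjoint_total[OF assms(4)] by blast
    then have "z \<bullet> g v = u \<bullet> v" using g(2) by (auto simp: op_adjoint_iff_inner[OF linG])
    moreover have "(v, u) \<in> op_adjoint G \<cdot> op_adjoint T"
      using u vz unfolding op_mult_def adjT[symmetric] by (rule relcompI[rotated])
    ultimately show ?thesis by (metis inner_commute)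
  qed
  have scale_mult: "(c *\<^sub>R x, c *\<^sub>R y) \<in> S \<cdot> R"
    if "(x, y) \<in> S \<cdot> R" "\<And>c x y. (x, y) \<in> S \<Longrightarrow> (c *\<^sub>R x, c *\<^sub>R y) \<in> S"
      "\<And>c x y. (x, y) \<in> R \<Longrightarrow> (c *\<^sub>R x, c *\<^sub>R y) \<in> R" for c x y and S R :: "'a operator"
    using that unfolding op_mult_def by blast
  have scale_adj: "(c *\<^sub>R x, c *\<^sub>R y) \<in> op_adjoint S"
    if "linear_operator S" "(x, y) \<in> op_adjoint S" for c x y and S :: "'a operator"
    using that(2) by (auto simp: op_adjoint_iff_inner[OF that(1)])
  note scale = linear_operator_scaleR[OF linT] linear_operator_scaleR[OF linG]
    linear_operator_scaleR[OF linW] scale_adj[OF linT] scale_adj[OF linG]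
  have "\<forall>c. \<forall>(x, y) \<in> G \<cdot> T. (c *\<^sub>R x, c *\<^sub>R y) \<in> G \<cdot> T"
    by (blast intro: scale_mult scale)
  note acc_GT = accretive_iff[OF this]
  have "\<forall>c. \<forall>(x, y) \<in> op_adjoint G \<cdot> op_adjoint T. (c *\<^sub>R x, c *\<^sub>R y) \<in> op_adjoint G \<cdot> op_adjoint T"
    by (blast intro: scale_mult scale)
  note acc_adj = accretive_iff[OF this]
  have "\<forall>c. \<forall>(x, y) \<in> G \<cdot> W. (c *\<^sub>R x, c *\<^sub>R y) \<in> G \<cdot> W"
    by (blast intro: scale_mult scale)
  note acc_GW = accretive_iff[OF this]
  have "\<forall>c. \<forall>(x, y) \<in> W \<cdot> G. (c *\<^sub>R x, c *\<^sub>R y) \<in> W \<cdot> G"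
    by (blast intro: scale_mult scale)
  note acc_WG = accretive_iff[OF this]
  have GT: "(x, g (w y)) \<in> G \<cdot> T" if "(x, y) \<in> A" for x y
    unfolding op_mult_def by (rule relcompI[of _ "w y"]) (use that in \<open>auto simp: T_iff g(2)\<close>)
  have GW: "(x, y) \<in> G \<cdot> W \<longleftrightarrow> y = g (w x)" and WG: "(x, y) \<in> W \<cdot> G \<longleftrightarrow> y = w (g x)" for x y
    by (auto simp: op_mult_def g(2) w(2))
  show ?thesis
  proof (intro conjI impI; elim conjE)
    assume *: "accretive (G \<cdot> T)" "accretive (op_adjoint G \<cdot> op_adjoint T)"
    have fwd: "x \<bullet> g (w y) \<ge> 0" if "(x, y) \<in> A" for x y
      using *(1) GT[OF that] by (auto simp: acc_GT)
    have adj: "g v \<bullet> z \<ge> 0" if "(v, z) \<in> adjoint_graph" for v z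
      using *(2) adjGT[OF that] by (force simp: acc_adj)
    show "accretive (G \<cdot> W)" "accretive (W \<cdot> G)"
      using GW_nonneg[OF g(1) fwd adj] WG_nonneg[OF g(1) fwd adj]
      by (auto simp: acc_GW acc_WG GW WG)
  next
    assume *: "strictly_accretive (G \<cdot> T)" "strictly_accretive (op_adjoint G \<cdot> op_adjoint T)"
    have fwd: "x \<bullet> g (w y) > 0" if "(x, y) \<in> A" "x \<noteq> 0" for x y
      using *(1) GT[OF that(1)] that(2) by (auto simp: acc_GT)
    have adj: "g v \<bullet> z > 0" if "(v, z) \<in> adjoint_graph" "v \<noteq> 0" for v z
      using *(2) adjGT[OF that(1)] that(2) by (force simp: acc_adj)
    have adj': "g v \<bullet> z \<ge> 0" if "(v, z) \<in> adjoint_graph" for v z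
      using adj[OF that] bounded_linear.linear[OF g(1)]
      by (cases "v = 0") (auto simp: linear_0)
    show "strictly_accretive (G \<cdot> W)" "strictly_accretive (W \<cdot> G)"
      using GW_pos[OF g(1) fwd adj'] WG_pos[OF g(1) fwd adj]
      by (auto simp: acc_GW acc_WG GW WG)
  qed
qed

end
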